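(* The countable random bipartite graph $\Gamma$ has the Strong Finite Bipartite Submodel Property (SFBSP).
   Context: A bipartite graph is a structure $(V,R_l,R_r,P_1,P_2)$ where $V$ is the disjoint union of nonempty sets $R_l$ and $R_r$ (the sides), and $P_1,P_2\subseteq R_l\times R_r$ are disjoint with $P_1\cup P_2=R_l\times R_r$. For $n\in\mathbb N$, the extension property $\Theta_n$ says: for any disjoint $X_{l1},X_{l2}\subseteq R_l$ of size at most $n$ and any disjoint $X_{r1},X_{r2}\subseteq R_r$ of size at most $n$, (a) there is $v\in R_r$ such that $P_i(x,v)$ for every $x\in X_{li}$, $i=1,2$; and (b) there is $w\in R_l$ such that $P_i(w,x)$ for every $x\in X_{ri}$, $i=1,2$. The random bipartite graph $\Gamma$ is the countable bipartite graph satisfying $\Theta_n$ for every $n\in\mathbb N$; it is unique up to isomorphism. A countably infinite bipartite graph $\Gamma$ has the Strong Finite Bipartite Submodel Property (SFBSP) if $\Gamma=\bigcup_{i\in\mathbb N}\Gamma_i$ is a union of an increasing chain of substructures $\Gamma_i$ such that: (1) $\Gamma_i\subset\Gamma_{i+1}$ and $|\Gamma_i|=i$ for each $i\in\mathbb N$; in particular, if $i$ is even then $|\Gamma_i\cap R_l|=|\Gamma_i\cap R_r|$, and otherwise $|\Gamma_i\cap R_l|=|\Gamma_i\cap R_r|+1$; (2) for any first-order sentence $\phi$ (in the language $R_l,R_r,P_1,P_2$) with $\Gamma\models\phi$, there exists $N\in\mathbb N$ such that $\Gamma_i\models\phi$ for all $i\geq N$. *)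

theory Defs
  imports Main "HOL-Library.Countable_Set"
begin

record 'a bistruct =
  Univ :: "'a set"
  Rl :: "'a set"
  Rr :: "'a set"
  P1 :: "('a \<times> 'a) set"
  P2 :: "('a \<times> 'a) set"

definition bipartite_graph :: "'a bistruct \<Rightarrow> bool" where
  "bipartite_graph G \<longleftrightarrow>
     Univ G = Rl G \<union> Rr G \<and> Rl G \<inter> Rr G = {} \<and> Rl G \<noteq> {} \<and> Rr G \<noteq> {} \<and>
     P1 G \<subseteq> Rl G \<times> Rr G \<and> P2 G \<subseteq> Rl G \<times> Rr G \<and>
     P1 G \<inter> P2 G = {} \<and> P1 G \<union> P2 G = Rl G \<times> Rr G"

definition extension_property :: "nat \<Rightarrow> 'a bistruct \<Rightarrow> bool" where
  "extension_property n G \<longleftrightarrow>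
     (\<forall>Xl1 Xl2 Xr1 Xr2.
        Xl1 \<subseteq> Rl G \<and> Xl2 \<subseteq> Rl G \<and> Xl1 \<inter> Xl2 = {} \<and>
        finite Xl1 \<and> card Xl1 \<le> n \<and> finite Xl2 \<and> card Xl2 \<le> n \<and>
        Xr1 \<subseteq> Rr G \<and> Xr2 \<subseteq> Rr G \<and> Xr1 \<inter> Xr2 = {} \<and>
        finite Xr1 \<and> card Xr1 \<le> n \<and> finite Xr2 \<and> card Xr2 \<le> n \<longrightarrow>
        (\<exists>v\<in>Rr G. (\<forall>x\<in>Xl1. (x, v) \<in> P1 G) \<and> (\<forall>x\<in>Xl2. (x, v) \<in> P2 G)) \<and>
        (\<exists>w\<in>Rl G. (\<forall>x\<in>Xr1. (w, x) \<in> P1 G) \<and> (\<forall>x\<in>Xr2. (w, x) \<in> P2 G)))"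

definition random_bipartite_graph :: "'a bistruct \<Rightarrow> bool" where
  "random_bipartite_graph G \<longleftrightarrow>
     bipartite_graph G \<and> countable (Univ G) \<and> (\<forall>n. extension_property n G)"

text \<open>First-order formulas with equality over the signature of \<open>bistruct\<close>; variables are
  named by natural numbers.\<close>

datatype fm =
    EqF nat nat
  | RlF nat
  | RrF nat
  | P1F nat nat
  | P2F nat nat
  | NegF fm
  | ConjF fm fm
  | DisjF fm fm
  | ImpF fm fm
  | ExF nat fm
  | AllF nat fm

fun fv :: "fm \<Rightarrow> nat set" where
  "fv (EqF x y) = {x, y}"
| "fv (RlF x) = {x}"
| "fv (RrF x) = {x}"
| "fv (P1F x y) = {x, y}"
| "fv (P2F x y) = {x, y}"
| "fv (NegF p) = fv p"
| "fv (ConjF p q) = fv p \<union> fv q"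
| "fv (DisjF p q) = fv p \<union> fv q"
| "fv (ImpF p q) = fv p \<union> fv q"
| "fv (ExF x p) = fv p - {x}"
| "fv (AllF x p) = fv p - {x}"

definition sentence :: "fm \<Rightarrow> bool" where
  "sentence p \<longleftrightarrow> fv p = {}"

fun sat :: "'a bistruct \<Rightarrow> (nat \<Rightarrow> 'a) \<Rightarrow> fm \<Rightarrow> bool" where
  "sat M e (EqF x y) \<longleftrightarrow> e x = e y"
| "sat M e (RlF x) \<longleftrightarrow> e x \<in> Rl M"
| "sat M e (RrF x) \<longleftrightarrow> e x \<in> Rr M"
| "sat M e (P1F x y) \<longleftrightarrow> (e x, e y) \<in> P1 M"
| "sat M e (P2F x y) \<longleftrightarrow> (e x, e y) \<in> P2 M"
| "sat M e (NegF p) \<longleftrightarrow> \<not> sat M e p"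
| "sat M e (ConjF p q) \<longleftrightarrow> sat M e p \<and> sat M e q"
| "sat M e (DisjF p q) \<longleftrightarrow> sat M e p \<or> sat M e q"
| "sat M e (ImpF p q) \<longleftrightarrow> (sat M e p \<longrightarrow> sat M e q)"
| "sat M e (ExF x p) \<longleftrightarrow> (\<exists>a\<in>Univ M. sat M (e(x := a)) p)"
| "sat M e (AllF x p) \<longleftrightarrow> (\<forall>a\<in>Univ M. sat M (e(x := a)) p)"

lemma sat_cong:
  "(\<And>x. x \<in> fv p \<Longrightarrow> e x = e' x) \<Longrightarrow> sat M e p \<longleftrightarrow> sat M e' p"
proof (induction p arbitrary: e e')
  case (NegF p)
  then have "sat M e p \<longleftrightarrow> sat M e' p" by (intro NegF.IH) simp
  then show ?case by simp
next
  case (ConjF p q)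
  have "sat M e p \<longleftrightarrow> sat M e' p" "sat M e q \<longleftrightarrow> sat M e' q"
    using ConjF.prems by (auto intro!: ConjF.IH)
  then show ?case by simp
next
  case (DisjF p q)
  have "sat M e p \<longleftrightarrow> sat M e' p" "sat M e q \<longleftrightarrow> sat M e' q"
    using DisjF.prems by (auto intro!: DisjF.IH)
  then show ?case by simp
next
  case (ImpF p q)
  have "sat M e p \<longleftrightarrow> sat M e' p" "sat M e q \<longleftrightarrow> sat M e' q"
    using ImpF.prems by (auto intro!: ImpF.IH)
  then show ?case by simp
next
  case (ExF x p)
  have "sat M (e(x := a)) p \<longleftrightarrow> sat M (e'(x := a)) p" for a
    using ExF.prems by (intro ExF.IH) simp
  then show ?case by simp
next
  case (AllF x p)
  have "sat M (e(x := a)) p \<longleftrightarrow> sat M (e'(x := a)) p" for a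
    using AllF.prems by (intro AllF.IH) simp
  then show ?case by simp
qed auto

text \<open>Assignments are not required to take values in \<open>Univ M\<close>. This makes no difference for
  sentences, whose truth value is independent of the assignment (\<open>models_iff_sat\<close>),
  and it gives the correct notion of truth also in the empty structure, where no assignment into
  \<open>Univ M\<close> exists.\<close>

definition models :: "'a bistruct \<Rightarrow> fm \<Rightarrow> bool" where
  "models M p \<longleftrightarrow> (\<forall>e. sat M e p)"

lemma models_iff_sat: "sentence p \<Longrightarrow> models M p \<longleftrightarrow> sat M e p"
  unfolding models_def sentence_def using sat_cong[of p] by blast

definition substructure :: "'a bistruct \<Rightarrow> 'a bistruct \<Rightarrow> bool" where
  "substructure M N \<longleftrightarrow>
     Univ M \<subseteq> Univ N \<and>
     Rl M = Rl N \<inter> Univ M \<and> Rr M = Rr N \<inter> Univ M \<and>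
     P1 M = P1 N \<inter> Univ M \<times> Univ M \<and> P2 M = P2 N \<inter> Univ M \<times> Univ M"

text \<open>The chain starts at \<open>i = 0\<close> with the empty structure, and the structure at \<open>i = 1\<close> has a
  single vertex, on the left side. So the members of the chain are only required to be
  substructures of \<open>G\<close>, not bipartite graphs with nonempty sides. Finiteness is
  explicit because \<open>card\<close> is 0 on infinite sets.\<close>

definition SFBSP :: "'a bistruct \<Rightarrow> bool" where
  "SFBSP G \<longleftrightarrow>
     bipartite_graph G \<and> countable (Univ G) \<and> infinite (Univ G) \<and>
     (\<exists>\<Gamma> :: nat \<Rightarrow> 'a bistruct.
        (\<forall>i. substructure (\<Gamma> i) G) \<and>
        Univ G = (\<Union>i. Univ (\<Gamma> i)) \<and>
        (\<forall>i. substructure (\<Gamma> i) (\<Gamma> (Suc i)) \<and> Univ (\<Gamma> i) \<subset> Univ (\<Gamma> (Suc i))) \<and>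
        (\<forall>i. finite (Univ (\<Gamma> i)) \<and> card (Univ (\<Gamma> i)) = i) \<and>
        (\<forall>i. if even i
             then card (Univ (\<Gamma> i) \<inter> Rl G) = card (Univ (\<Gamma> i) \<inter> Rr G)
             else card (Univ (\<Gamma> i) \<inter> Rl G) = card (Univ (\<Gamma> i) \<inter> Rr G) + 1) \<and>
        (\<forall>p. sentence p \<and> models G p \<longrightarrow> (\<exists>N. \<forall>i\<ge>N. models (\<Gamma> i) p)))"

end

theory Submission
  imports Defs "HOL-Probability.Probability" "HOL-Real_Asymp.Real_Asymp"
begin

text \<open>Colour the natural numbers by parity and choose the edges between even and odd numbers by
  independent fair coins. The probability that the initial segment \<open>{..<i}\<close> violates the extension
  property for a fixed \<open>n\<close> is at most a polynomial in \<open>i\<close> times a geometrically decaying factor, so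
  by Borel--Cantelli there is one outcome \<open>H\<close> whose initial segments eventually have each
  extension property. Then \<open>H\<close> itself has all of them, hence is isomorphic to \<open>G\<close> by
  back-and-forth, and the chain in \<open>G\<close> is the image of the initial segments of \<open>H\<close>. Any two
  bipartite graphs with a sufficiently strong extension property agree on a given sentence, by an
  Ehrenfeucht--Fraisse argument, so truth in \<open>G\<close> passes to almost all members of the chain.\<close>

subsection \<open>Extending partial isomorphisms\<close>

text \<open>Non-edges take the place of \<open>P2\<close>, and the sides and the relation are
  parameters: exchanging \<open>A\<close> and \<open>B\<close> and transposing \<open>R\<close>
  turns one half of the extension property into the other, so that \<open>fresh_witness\<close>
  serves both.\<close>

definition one_sided_extension :: "nat \<Rightarrow> 'a set \<Rightarrow> 'a set \<Rightarrow> ('a \<Rightarrow> 'a \<Rightarrow> bool) \<Rightarrow> bool" where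
  "one_sided_extension n A B R \<longleftrightarrow>
     (\<forall>X Y. X \<subseteq> A \<and> Y \<subseteq> A \<and> X \<inter> Y = {} \<and> finite X \<and> card X \<le> n \<and> finite Y \<and> card Y \<le> n \<longrightarrow>
        (\<exists>v\<in>B. (\<forall>x\<in>X. R x v) \<and> (\<forall>x\<in>Y. \<not> R x v)))"

lemma one_sided_extensionD:
  assumes "one_sided_extension n A B R" "X \<subseteq> A" "Y \<subseteq> A" "X \<inter> Y = {}"
    "finite X" "card X \<le> n" "finite Y" "card Y \<le> n"
  shows "\<exists>v\<in>B. (\<forall>x\<in>X. R x v) \<and> (\<forall>x\<in>Y. \<not> R x v)"
  using assms unfolding one_sided_extension_def by blast

section \<open>Extension properties of bipartite graphs, one side at a time\<close>

lemma Rr_iff: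
  assumes "bipartite_graph G" "a \<in> Univ G"
  shows "a \<in> Rr G \<longleftrightarrow> a \<notin> Rl G"
  using assms unfolding bipartite_graph_def by blast

lemma P2_iff:
  assumes "bipartite_graph G" "a \<in> Univ G" "b \<in> Univ G"
  shows "(a, b) \<in> P2 G \<longleftrightarrow> a \<in> Rl G \<and> b \<notin> Rl G \<and> (a, b) \<notin> P1 G"
  using assms unfolding bipartite_graph_def by blast

lemma P1_irrefl:
  assumes "bipartite_graph G"
  shows "(a, a) \<notin> P1 G"
proof
  assume "(a, a) \<in> P1 G"
  then have "(a, a) \<in> Rl G \<times> Rr G" "Rl G \<inter> Rr G = {}"
    using assms unfolding bipartite_graph_def by auto
  then show False by auto
qed

text \<open>Between vertices of opposite sides \<open>P2\<close> is the complement of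
  \<open>P1\<close>, and leaving the sets on one side empty separates the two halves of the
  property.\<close>

lemma extension_property_iff:
  assumes "bipartite_graph G"
  shows "extension_property n G \<longleftrightarrow>
    one_sided_extension n (Rl G) (Rr G) (\<lambda>x v. (x, v) \<in> P1 G) \<and>
    one_sided_extension n (Rr G) (Rl G) (\<lambda>v x. (x, v) \<in> P1 G)" (is "?L \<longleftrightarrow> ?R1 \<and> ?R2")
proof -
  have P2: "(x, v) \<in> P2 G \<longleftrightarrow> (x, v) \<notin> P1 G" if "x \<in> Rl G" "v \<in> Rr G" for x v
    using assms that unfolding bipartite_graph_def by blast
  show ?thesis
  proof (intro iffI conjI)
    assume L: ?L
    show ?R1
      unfolding one_sided_extension_def
    proof (intro allI impI)
      fix X Y assume "X \<subseteq> Rl G \<and> Y \<subseteq> Rl G \<and> X \<inter> Y = {} \<and> finite X \<and> card X \<le> n \<and> finite Y \<and> card Y \<le> n"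
      with L[unfolded extension_property_def, rule_format, of X Y "{}" "{}"]
      show "\<exists>v\<in>Rr G. (\<forall>x\<in>X. (x, v) \<in> P1 G) \<and> (\<forall>x\<in>Y. (x, v) \<notin> P1 G)"
        using P2 by (auto simp: subset_iff)
    qed
    show ?R2
      unfolding one_sided_extension_def
    proof (intro allI impI)
      fix X Y assume "X \<subseteq> Rr G \<and> Y \<subseteq> Rr G \<and> X \<inter> Y = {} \<and> finite X \<and> card X \<le> n \<and> finite Y \<and> card Y \<le> n"
      with L[unfolded extension_property_def, rule_format, of "{}" "{}" X Y]
      show "\<exists>v\<in>Rl G. (\<forall>x\<in>X. (v, x) \<in> P1 G) \<and> (\<forall>x\<in>Y. (v, x) \<notin> P1 G)"
        using P2 by (auto simp: subset_iff)
    qed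
  next
    assume R: "?R1 \<and> ?R2"
    show ?L
      unfolding extension_property_def
    proof (intro allI impI conjI; elim conjE)
      fix X Y assume *: "X \<subseteq> Rl G" "Y \<subseteq> Rl G" "X \<inter> Y = {}" "finite X" "card X \<le> n" "finite Y" "card Y \<le> n"
      from one_sided_extensionD[OF conjunct1[OF R] this]
      show "\<exists>v\<in>Rr G. (\<forall>x\<in>X. (x, v) \<in> P1 G) \<and> (\<forall>x\<in>Y. (x, v) \<in> P2 G)"
        using P2 * by (meson subsetD)
    next
      fix X Y assume *: "X \<subseteq> Rr G" "Y \<subseteq> Rr G" "X \<inter> Y = {}" "finite X" "card X \<le> n" "finite Y" "card Y \<le> n"
      from one_sided_extensionD[OF conjunct2[OF R] this]
      show "\<exists>v\<in>Rl G. (\<forall>x\<in>X. (v, x) \<in> P1 G) \<and> (\<forall>x\<in>Y. (v, x) \<in> P2 G)"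
        using P2 * by (meson subsetD)
    qed
  qed
qed

lemma extension_property_mono:
  "extension_property n G \<Longrightarrow> m \<le> n \<Longrightarrow> extension_property m G"
  unfolding extension_property_def by (intro allI impI, elim allE, erule mp) auto

lemma fresh_witness:
  assumes AB: "one_sided_extension (Suc n) A B R"
    and BA: "one_sided_extension (Suc n) B A (\<lambda>v x. R x v)"
    and X: "X \<subseteq> A" "Y \<subseteq> A" "X \<inter> Y = {}" "finite X" "finite Y" "card (X \<union> Y) \<le> n"
    and F: "F \<subseteq> B" "finite F" "card F \<le> n"
  shows "\<exists>v\<in>B - F. (\<forall>x\<in>X. R x v) \<and> (\<forall>x\<in>Y. \<not> R x v)"
proof -
  \<comment> \<open>A vertex \<open>w\<close> outside \<open>X \<union> Y\<close> joined to all of \<open>F\<close> forces freshness: a \<open>v\<close> not joined to \<open>w\<close> avoids \<open>F\<close>.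
    To keep \<open>w\<close> out of \<open>X \<union> Y\<close>, join it to a \<open>u\<close> that has no neighbour there.\<close>
  obtain u where u: "u \<in> B" "\<forall>x\<in>X \<union> Y. \<not> R x u"
    using one_sided_extensionD[OF AB, of "{}" "X \<union> Y"] X by auto
  \<comment> \<open>The level \<open>Suc n\<close> pays for one extra vertex in each request:
    \<open>u\<close> beside \<open>F\<close> here, \<open>w\<close> beside \<open>Y\<close>
    below.\<close>
  have "card (insert u F) \<le> Suc n"
    using F by (simp add: card_insert_if)
  then obtain w where w: "w \<in> A" "\<forall>y\<in>insert u F. R w y"
    using one_sided_extensionD[OF BA, of "insert u F" "{}"] F u by auto
  have wXY: "w \<notin> X \<union> Y" using u w by auto
  have "card X \<le> n" "card Y \<le> n"
    using X card_mono[of "X \<union> Y" X] card_mono[of "X \<union> Y" Y] by auto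
  then obtain v where "v \<in> B" "\<forall>x\<in>X. R x v" "\<forall>x\<in>insert w Y. \<not> R x v"
    using one_sided_extensionD[OF AB, of X "insert w Y"] X w wXY
    by (auto simp: card_insert_if)
  then show ?thesis using w by auto
qed

text \<open>A relation instead of a map, so that taking the converse exchanges the two structures.
  Only \<open>Rl\<close> and \<open>P1\<close> occur, because they determine \<open>Rr\<close> and
  \<open>P2\<close> in a bipartite graph.\<close>

definition partial_iso :: "'a bistruct \<Rightarrow> 'b bistruct \<Rightarrow> ('a \<times> 'b) set \<Rightarrow> bool" where
  "partial_iso M N S \<longleftrightarrow>
     (\<forall>a b c d. (a, b) \<in> S \<longrightarrow> (c, d) \<in> S \<longrightarrow>
        a \<in> Univ M \<and> b \<in> Univ N \<and> (a \<in> Rl M \<longleftrightarrow> b \<in> Rl N) \<and>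
        (a = c \<longleftrightarrow> b = d) \<and> ((a, c) \<in> P1 M \<longleftrightarrow> (b, d) \<in> P1 N))"

lemma partial_isoI:
  assumes "\<And>a b c d. (a, b) \<in> S \<Longrightarrow> (c, d) \<in> S \<Longrightarrow>
    a \<in> Univ M \<and> b \<in> Univ N \<and> (a \<in> Rl M \<longleftrightarrow> b \<in> Rl N) \<and>
    (a = c \<longleftrightarrow> b = d) \<and> ((a, c) \<in> P1 M \<longleftrightarrow> (b, d) \<in> P1 N)"
  shows "partial_iso M N S"
  unfolding partial_iso_def by (intro allI impI assms)

lemma partial_isoD:
  assumes "partial_iso M N S" "(a, b) \<in> S"
  shows "a \<in> Univ M" "b \<in> Univ N" "a \<in> Rl M \<longleftrightarrow> b \<in> Rl N"
    and "(c, d) \<in> S \<Longrightarrow> a = c \<longleftrightarrow> b = d"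
    and "(c, d) \<in> S \<Longrightarrow> (a, c) \<in> P1 M \<longleftrightarrow> (b, d) \<in> P1 N"
  using assms(1)[unfolded partial_iso_def, rule_format, OF assms(2) assms(2)]
    assms(1)[unfolded partial_iso_def, rule_format, OF assms(2), of c d] by simp_all

lemma partial_iso_empty [simp]: "partial_iso M N {}"
  by (simp add: partial_iso_def)

lemma partial_iso_subset: "partial_iso M N S \<Longrightarrow> T \<subseteq> S \<Longrightarrow> partial_iso M N T"
  unfolding partial_iso_def by blast

lemma partial_iso_converse: "partial_iso M N S \<Longrightarrow> partial_iso N M (S\<inverse>)"
  unfolding partial_iso_def by simp

text \<open>The conditions concern only two pairs at a time, and any two pairs of the union lie in a
  common member of the chain.\<close>

lemma partial_iso_Union_chain:
  assumes "\<And>n::nat. partial_iso M N (S n)" "\<And>n. S n \<subseteq> S (Suc n)"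
  shows "partial_iso M N (\<Union>n. S n)"
proof -
  have mono: "S m \<subseteq> S n" if "m \<le> n" for m n
    using that assms(2) by (rule lift_Suc_mono_le[rotated])
  show ?thesis
  proof (rule partial_isoI)
    fix a b c d assume "(a, b) \<in> (\<Union>n. S n)" "(c, d) \<in> (\<Union>n. S n)"
    then obtain i j where "(a, b) \<in> S i" "(c, d) \<in> S j" by blast
    then have *: "(a, b) \<in> S (max i j)" "(c, d) \<in> S (max i j)"
      using mono[of i "max i j"] mono[of j "max i j"] by auto
    show "a \<in> Univ M \<and> b \<in> Univ N \<and> (a \<in> Rl M \<longleftrightarrow> b \<in> Rl N) \<and>
      (a = c \<longleftrightarrow> b = d) \<and> ((a, c) \<in> P1 M \<longleftrightarrow> (b, d) \<in> P1 N)"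
      by (intro conjI) (rule partial_isoD[OF assms(1) *(1)] partial_isoD(4,5)[OF assms(1) *])+
  qed
qed

text \<open>A bipartite graph has no loops, so the new pair is compatible with itself. What remains
  is its relation to each old pair, in both orders because \<open>P1\<close> is directed.\<close>

lemma partial_iso_insert:
  assumes "partial_iso M N S" "a \<in> Univ M" "b \<in> Univ N" "a \<in> Rl M \<longleftrightarrow> b \<in> Rl N"
    and "bipartite_graph M" "bipartite_graph N"
    and "\<And>c d. (c, d) \<in> S \<Longrightarrow> a \<noteq> c \<and> b \<noteq> d \<and> ((a, c) \<in> P1 M \<longleftrightarrow> (b, d) \<in> P1 N) \<and> ((c, a) \<in> P1 M \<longleftrightarrow> (d, b) \<in> P1 N)"
  shows "partial_iso M N (insert (a, b) S)"
proof -
  have loop: "(a, a) \<notin> P1 M" "(b, b) \<notin> P1 N"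
    by (intro P1_irrefl assms(5,6))+
  note SD = partial_isoD[OF assms(1)]
  show ?thesis
  proof (rule partial_isoI)
    fix c d c' d'
    assume "(c, d) \<in> insert (a, b) S" "(c', d') \<in> insert (a, b) S"
    then consider "(c, d) = (a, b)" "(c', d') = (a, b)" | "(c, d) = (a, b)" "(c', d') \<in> S"
      | "(c, d) \<in> S" "(c', d') = (a, b)" | "(c, d) \<in> S" "(c', d') \<in> S" by blast
    then show "c \<in> Univ M \<and> d \<in> Univ N \<and> (c \<in> Rl M \<longleftrightarrow> d \<in> Rl N) \<and>
      (c = c' \<longleftrightarrow> d = d') \<and> ((c, c') \<in> P1 M \<longleftrightarrow> (d, d') \<in> P1 N)"
    proof cases
      case 1
      then show ?thesis using loop assms(2-4) by simp
    next
      case 2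
      then show ?thesis using assms(2-4) assms(7)[OF 2(2)] by simp
    next
      case 3
      then show ?thesis using SD(1-3)[OF 3(1)] assms(7)[OF 3(1)] by auto
    next
      case 4
      then show ?thesis using SD(1-3)[OF 4(1)] SD(4,5)[OF 4] by blast
    qed
  qed
qed

text \<open>This is the forth step. The edges between \<open>a\<close> and matched vertices
  prescribe the edges between \<open>b\<close> and their partners, a finite demand that
  \<open>fresh_witness\<close> meets while keeping \<open>b\<close> distinct from all earlier
  partners.\<close>

lemma partial_iso_extend:
  assumes M: "bipartite_graph M" and N: "bipartite_graph N"
    and S: "partial_iso M N S" "finite S" "card S \<le> n"
    and ext: "extension_property (Suc n) N"
    and a: "a \<in> Univ M"
  shows "\<exists>b. partial_iso M N (insert (a, b) S)"
proof (cases "a \<in> Domain S")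
  case True
  then obtain b where "(a, b) \<in> S" by blast
  then show ?thesis using S by (auto simp: insert_absorb intro!: exI[of _ b])
next
  case new: False
  let ?E = "\<lambda>x v. (x, v) \<in> P1 N"
  have l: "one_sided_extension (Suc n) (Rl N) (Rr N) ?E"
    and r: "one_sided_extension (Suc n) (Rr N) (Rl N) (\<lambda>v x. ?E x v)"
    using ext extension_property_iff[OF N] by auto
  have M': "Univ M = Rl M \<union> Rr M" "Rl M \<inter> Rr M = {}" "P1 M \<subseteq> Rl M \<times> Rr M"
    and N': "Univ N = Rl N \<union> Rr N" "Rl N \<inter> Rr N = {}" "P1 N \<subseteq> Rl N \<times> Rr N"
    using M N unfolding bipartite_graph_def by auto
  have small: "finite T \<and> card T \<le> n" if "T \<subseteq> snd ` S" for T
    using that S card_image_le[of S snd] card_mono[of "snd ` S" T] finite_subset[of T "snd ` S"] by auto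
  note SD = partial_isoD[OF S(1)]
  show ?thesis
  proof (cases "a \<in> Rl M")
    case True
    \<comment> \<open>\<open>X\<close> and \<open>Y\<close> collect the partners of the neighbours
      and of the non-neighbours of \<open>a\<close> on the opposite side. \<open>F\<close> lists the
      partners on the side of \<open>b\<close>; those on the other side differ from \<open>b\<close>
      automatically.\<close>
    define X where "X = {d. \<exists>c. (c, d) \<in> S \<and> (a, c) \<in> P1 M}"
    define Y where "Y = {d. \<exists>c. (c, d) \<in> S \<and> c \<in> Rr M \<and> (a, c) \<notin> P1 M}"
    define F where "F = {d. \<exists>c. (c, d) \<in> S \<and> d \<in> Rl N}"
    have "X \<subseteq> Rr N" "Y \<subseteq> Rr N" "F \<subseteq> Rl N"
      using SD(1-3) M' N' unfolding X_def Y_def F_def by blast+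
    moreover have "X \<inter> Y = {}"
      using SD(4) unfolding X_def Y_def by blast
    moreover have "X \<union> Y \<subseteq> snd ` S" "F \<subseteq> snd ` S"
      unfolding X_def Y_def F_def by force+
    ultimately obtain b where b: "b \<in> Rl N" "b \<notin> F" "\<forall>x\<in>X. ?E b x" "\<forall>x\<in>Y. \<not> ?E b x"
      using fresh_witness[OF r l, of X Y F] small[of "X \<union> Y"] small[of F] by auto
    have "partial_iso M N (insert (a, b) S)"
    proof (rule partial_iso_insert[OF S(1) a _ _ M N])
      fix c d assume cd: "(c, d) \<in> S"
      have "b \<noteq> d" using b cd F_def by blast
      moreover have "(a, c) \<in> P1 M \<longleftrightarrow> (b, d) \<in> P1 N"
        using b cd SD(1-3)[OF cd] M' N' unfolding X_def Y_def by blast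
      ultimately show "a \<noteq> c \<and> b \<noteq> d \<and> ((a, c) \<in> P1 M \<longleftrightarrow> (b, d) \<in> P1 N) \<and> ((c, a) \<in> P1 M \<longleftrightarrow> (d, b) \<in> P1 N)"
        using cd new True b M' N' by blast
    qed (use True b N' in auto)
    then show ?thesis ..
  next
    case False
    then have ar: "a \<in> Rr M" using a M' by auto
    \<comment> \<open>The mirror image: \<open>a\<close> is now the second component of its edges,
      and \<open>l\<close> and \<open>r\<close> exchange their roles in
      \<open>fresh_witness\<close>.\<close>
    define X where "X = {d. \<exists>c. (c, d) \<in> S \<and> (c, a) \<in> P1 M}"
    define Y where "Y = {d. \<exists>c. (c, d) \<in> S \<and> c \<in> Rl M \<and> (c, a) \<notin> P1 M}"
    define F where "F = {d. \<exists>c. (c, d) \<in> S \<and> d \<in> Rr N}"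
    have "X \<subseteq> Rl N" "Y \<subseteq> Rl N" "F \<subseteq> Rr N"
      using SD(1-3) M' N' unfolding X_def Y_def F_def by blast+
    moreover have "X \<inter> Y = {}"
      using SD(4) unfolding X_def Y_def by blast
    moreover have "X \<union> Y \<subseteq> snd ` S" "F \<subseteq> snd ` S"
      unfolding X_def Y_def F_def by force+
    ultimately obtain b where b: "b \<in> Rr N" "b \<notin> F" "\<forall>x\<in>X. ?E x b" "\<forall>x\<in>Y. \<not> ?E x b"
      using fresh_witness[OF l r, of X Y F] small[of "X \<union> Y"] small[of F] by auto
    have "partial_iso M N (insert (a, b) S)"
    proof (rule partial_iso_insert[OF S(1) a _ _ M N])
      fix c d assume cd: "(c, d) \<in> S"
      have "b \<noteq> d" using b cd F_def by blast
      moreover have "(c, a) \<in> P1 M \<longleftrightarrow> (d, b) \<in> P1 N"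
        using b cd SD(1-3)[OF cd] M' N' unfolding X_def Y_def by blast
      ultimately show "a \<noteq> c \<and> b \<noteq> d \<and> ((a, c) \<in> P1 M \<longleftrightarrow> (b, d) \<in> P1 N) \<and> ((c, a) \<in> P1 M \<longleftrightarrow> (d, b) \<in> P1 N)"
        using cd new ar b M' N' by blast
    qed (use False b N' in auto)
    then show ?thesis ..
  qed
qed

lemma partial_iso_extend_converse:
  assumes "bipartite_graph M" "bipartite_graph N"
    and "partial_iso M N S" "finite S" "card S \<le> n"
    and "extension_property (Suc n) M" "b \<in> Univ N"
  shows "\<exists>a. partial_iso M N (insert (a, b) S)"
proof -
  have "finite (S\<inverse>)" "card (S\<inverse>) \<le> n"
    using assms(4,5) by simp_all
  from partial_iso_extend[OF assms(2,1) partial_iso_converse[OF assms(3)] this assms(6,7)]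
  obtain a where "partial_iso N M (insert (b, a) (S\<inverse>))" ..
  moreover have "(insert (b, a) (S\<inverse>))\<inverse> = insert (a, b) S" by auto
  ultimately have "partial_iso M N (insert (a, b) S)"
    using partial_iso_converse[of N M "insert (b, a) (S\<inverse>)"] by simp
  then show ?thesis ..
qed

section \<open>Transfer of first-order truth between graphs\<close>

lemma finite_fv: "finite (fv p)"
  by (induction p) auto

text \<open>As in an Ehrenfeucht-Fraisse game, matched assignments agree on atoms, and a value
  chosen for a quantified variable in either structure is answered in the other by extending the
  partial isomorphism. The level \<open>k\<close> depends on the formula, not on the structures or
  assignments.\<close>

lemma sat_transfer:
  "\<exists>k. \<forall>(M :: 'a bistruct) (N :: 'b bistruct) e e'.
     bipartite_graph M \<longrightarrow> bipartite_graph N \<longrightarrow> extension_property k M \<longrightarrow> extension_property k N \<longrightarrow>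
     partial_iso M N ((\<lambda>x. (e x, e' x)) ` fv p) \<longrightarrow> sat M e p = sat N e' p" (is "\<exists>k. ?T k p")
proof -
  have mono: "?T l p" if "?T k p" "k \<le> l" for k l p
    by (intro allI impI that(1)[rule_format] extension_property_mono[OF _ that(2)])
  have neg: "\<exists>k. ?T k (NegF p)" if "\<exists>k. ?T k p" for p
    using that by (simp only: fv.simps sat.simps) simp
  have conj: "\<exists>k. ?T k (ConjF p q)" if p: "\<exists>k. ?T k p" and q: "\<exists>k. ?T k q" for p q
  proof -
    obtain k where k: "?T k p" using p ..
    obtain l where l: "?T l q" using q ..
    note * = mono[OF k max.cobounded1[of k l]] mono[OF l max.cobounded2[of l k]]
    have "?T (max k l) (ConjF p q)"
    proof (intro allI impI)
      fix M :: "'a bistruct" and N :: "'b bistruct" and e e'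
      assume MN: "bipartite_graph M" "bipartite_graph N"
        "extension_property (max k l) M" "extension_property (max k l) N"
        and iso: "partial_iso M N ((\<lambda>x. (e x, e' x)) ` fv (ConjF p q))"
      have "partial_iso M N ((\<lambda>x. (e x, e' x)) ` fv p)" "partial_iso M N ((\<lambda>x. (e x, e' x)) ` fv q)"
        by (rule partial_iso_subset[OF iso]; auto)+
      then show "sat M e (ConjF p q) = sat N e' (ConjF p q)"
        using *(1)[rule_format, OF MN] *(2)[rule_format, OF MN] by simp
    qed
    then show ?thesis ..
  qed
  have ex: "\<exists>k. ?T k (ExF x p)" if p: "\<exists>k. ?T k p" for x p
  proof -
    obtain k where k: "?T k p" using p ..
    \<comment> \<open>At most \<open>n\<close> pairs are matched before the quantified variable gets
      its value, so level \<open>Suc n\<close> provides the answer and level \<open>k\<close>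
      handles the body \<open>p\<close>.\<close>
    define n where "n = card (fv p - {x})"
    have "?T (max k (Suc n)) (ExF x p)"
    proof (intro allI impI)
      fix M :: "'a bistruct" and N :: "'b bistruct" and e e'
      assume bip: "bipartite_graph M" "bipartite_graph N"
        and ext: "extension_property (max k (Suc n)) M" "extension_property (max k (Suc n)) N"
        and iso: "partial_iso M N ((\<lambda>x. (e x, e' x)) ` fv (ExF x p))"
      define S where "S = (\<lambda>x. (e x, e' x)) ` (fv p - {x})"
      have S: "partial_iso M N S" "finite S" "card S \<le> n"
        using iso finite_fv[of p] by (auto simp: S_def n_def card_image_le)
      have extn: "extension_property (Suc n) M" "extension_property (Suc n) N"
        and extk: "extension_property k M" "extension_property k N"
        using ext by (auto intro: extension_property_mono)
      have step: "sat M (e(x := a)) p = sat N (e'(x := b)) p"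
        if "partial_iso M N (insert (a, b) S)" for a b
      proof -
        have "(\<lambda>y. ((e(x := a)) y, (e'(x := b)) y)) ` fv p \<subseteq> insert (a, b) S"
          by (auto simp: S_def)
        with that have "partial_iso M N ((\<lambda>y. ((e(x := a)) y, (e'(x := b)) y)) ` fv p)"
          by (rule partial_iso_subset)
        then show ?thesis by (rule k[rule_format, OF bip extk])
      qed
      show "sat M e (ExF x p) = sat N e' (ExF x p)"
      proof
        assume "sat M e (ExF x p)"
        then obtain a where a: "a \<in> Univ M" "sat M (e(x := a)) p" by auto
        obtain b where "partial_iso M N (insert (a, b) S)"
          using partial_iso_extend[OF bip S extn(2) a(1)] ..
        then show "sat N e' (ExF x p)"
          using a step partial_isoD(2)[of M N _ a b] by auto
      next
        assume "sat N e' (ExF x p)"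
        then obtain b where b: "b \<in> Univ N" "sat N (e'(x := b)) p" by auto
        obtain a where "partial_iso M N (insert (a, b) S)"
          using partial_iso_extend_converse[OF bip S extn(1) b(1)] ..
        then show "sat M e (ExF x p)"
          using b step partial_isoD(1)[of M N _ a b] by auto
      qed
    qed
    then show ?thesis ..
  qed
  show ?thesis
  proof (induction p)
    case (EqF x y)
    show ?case
    proof (intro exI[of _ 0] allI impI)
      fix M :: "'a bistruct" and N :: "'b bistruct" and e e'
      assume MN: "bipartite_graph M" "bipartite_graph N"
        and "partial_iso M N ((\<lambda>x. (e x, e' x)) ` fv (EqF x y))"
      then have iso: "partial_iso M N {(e x, e' x), (e y, e' y)}"
        by simp
      show "sat M e (EqF x y) = sat N e' (EqF x y)"
        unfolding sat.simps using partial_isoD(4)[OF iso insertI1] by simp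
    qed
  next
    case (RlF x)
    show ?case
    proof (intro exI[of _ 0] allI impI)
      fix M :: "'a bistruct" and N :: "'b bistruct" and e e'
      assume MN: "bipartite_graph M" "bipartite_graph N"
        and "partial_iso M N ((\<lambda>x. (e x, e' x)) ` fv (RlF x))"
      then have iso: "partial_iso M N {(e x, e' x)}"
        by simp
      show "sat M e (RlF x) = sat N e' (RlF x)"
        unfolding sat.simps using partial_isoD(3)[OF iso insertI1] .
    qed
  next
    case (RrF x)
    show ?case
    proof (intro exI[of _ 0] allI impI)
      fix M :: "'a bistruct" and N :: "'b bistruct" and e e'
      assume MN: "bipartite_graph M" "bipartite_graph N"
        and "partial_iso M N ((\<lambda>x. (e x, e' x)) ` fv (RrF x))"
      then have iso: "partial_iso M N {(e x, e' x)}"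
        by simp
      show "sat M e (RrF x) = sat N e' (RrF x)"
        unfolding sat.simps using partial_isoD(1-3)[OF iso insertI1] Rr_iff[OF MN(1)] Rr_iff[OF MN(2)] by simp
    qed
  next
    case (P1F x y)
    show ?case
    proof (intro exI[of _ 0] allI impI)
      fix M :: "'a bistruct" and N :: "'b bistruct" and e e'
      assume MN: "bipartite_graph M" "bipartite_graph N"
        and "partial_iso M N ((\<lambda>x. (e x, e' x)) ` fv (P1F x y))"
      then have iso: "partial_iso M N {(e x, e' x), (e y, e' y)}"
        by simp
      show "sat M e (P1F x y) = sat N e' (P1F x y)"
        unfolding sat.simps using partial_isoD(5)[OF iso insertI1] by simp
    qed
  next
    case (P2F x y)
    show ?case
    proof (intro exI[of _ 0] allI impI)
      fix M :: "'a bistruct" and N :: "'b bistruct" and e e'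
      assume MN: "bipartite_graph M" "bipartite_graph N"
        and "partial_iso M N ((\<lambda>x. (e x, e' x)) ` fv (P2F x y))"
      then have iso: "partial_iso M N {(e x, e' x), (e y, e' y)}"
        by simp
      show "sat M e (P2F x y) = sat N e' (P2F x y)"
        unfolding sat.simps using partial_isoD(1-3)[OF iso, of "e x" "e' x"]
          partial_isoD(1-3)[OF iso, of "e y" "e' y"] partial_isoD(5)[OF iso insertI1, of "e y" "e' y"]
        by (simp add: P2_iff[OF MN(1)] P2_iff[OF MN(2)])
    qed
  next
    case (NegF p)
    then show ?case by (rule neg)
  next
    case (ConjF p q)
    then show ?case by (rule conj)
  next
    \<comment> \<open>Disjunction, implication and universal quantification reduce to negation,
      conjunction and existence by classical equivalences that also preserve the free
      variables.\<close>
    case (DisjF p q)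
    then have "\<exists>k. ?T k (NegF (ConjF (NegF p) (NegF q)))"
      by (intro conj neg)
    then show ?case by simp
  next
    case (ImpF p q)
    then have "\<exists>k. ?T k (NegF (ConjF p (NegF q)))"
      by (intro conj neg)
    then show ?case by simp
  next
    case (ExF x p)
    then show ?case by (rule ex)
  next
    case (AllF x p)
    then have "\<exists>k. ?T k (NegF (ExF x (NegF p)))"
      by (intro ex neg)
    then show ?case by simp
  qed
qed

text \<open>Every vertex of either structure receives a partner at some finite stage, so the union
  of the stages is the graph of an isomorphism. All levels of the extension property are assumed
  because the number of matched pairs grows with the stages.\<close>

lemma back_and_forth:
  fixes M :: "'a bistruct" and N :: "'b bistruct"
  assumes M: "bipartite_graph M" "countable (Univ M)" "\<And>n. extension_property n M"
    and N: "bipartite_graph N" "countable (Univ N)" "\<And>n. extension_property n N"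
  shows "\<exists>h. bij_betw h (Univ M) (Univ N) \<and> (\<forall>a\<in>Univ M. h a \<in> Rl N \<longleftrightarrow> a \<in> Rl M) \<and>
    (\<forall>a\<in>Univ M. \<forall>b\<in>Univ M. (h a, h b) \<in> P1 N \<longleftrightarrow> (a, b) \<in> P1 M)"
proof -
  have ne: "Univ M \<noteq> {}" "Univ N \<noteq> {}"
    using M(1) N(1) unfolding bipartite_graph_def by auto
  \<comment> \<open>\<open>from_nat_into\<close> runs through every element of a nonempty countable
    set. Repetitions do no harm, as a matched vertex merely keeps its partner.\<close>
  define m where "m = from_nat_into (Univ M)"
  define n where "n = from_nat_into (Univ N)"
  \<comment> \<open>Stage \<open>Suc i\<close> matches the \<open>i\<close>-th entry of both
    enumerations: the forth step takes care of \<open>m i\<close>, the back step of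
    \<open>n i\<close>.\<close>
  have "\<exists>S. \<forall>i. (partial_iso M N (S i) \<and> finite (S i)) \<and>
      (S i \<subseteq> S (Suc i) \<and> m i \<in> Domain (S (Suc i)) \<and> n i \<in> Range (S (Suc i)))"
  proof (rule dependent_nat_choice)
    show "\<exists>S. partial_iso M N S \<and> finite S"
      by (intro exI[of _ "{}"]) simp
  next
    fix S i assume S: "partial_iso M N S \<and> finite S"
    have mi: "m i \<in> Univ M" and ni: "n i \<in> Univ N"
      using ne by (simp_all add: m_def n_def from_nat_into)
    obtain b where b: "partial_iso M N (insert (m i, b) S)"
      using partial_iso_extend[OF M(1) N(1) _ _ order_refl N(3) mi] S by blast
    obtain a where "partial_iso M N (insert (a, n i) (insert (m i, b) S))"
      using partial_iso_extend_converse[OF M(1) N(1) b _ order_refl M(3) ni] S by blast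
    then show "\<exists>T. (partial_iso M N T \<and> finite T) \<and>
        S \<subseteq> T \<and> m i \<in> Domain T \<and> n i \<in> Range T"
      using S by (intro exI[of _ "insert (a, n i) (insert (m i, b) S)"]) auto
  qed
  then obtain S where S: "\<And>i. partial_iso M N (S i)" "\<And>i. S i \<subseteq> S (Suc i)"
    "\<And>i. m i \<in> Domain (S (Suc i))" "\<And>i. n i \<in> Range (S (Suc i))" by blast
  define R where "R = (\<Union>i. S i)"
  have R: "partial_iso M N R"
    unfolding R_def by (rule partial_iso_Union_chain) (fact S)+
  note RD = partial_isoD[OF R]
  have dom: "\<exists>b. (a, b) \<in> R" if a: "a \<in> Univ M" for a
  proof -
    obtain i where "a = m i"
      using from_nat_into_surj[OF M(2) a] unfolding m_def by metis
    then show ?thesis using S(3)[of i] unfolding R_def by blast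
  qed
  have ran: "\<exists>a. (a, b) \<in> R" if b: "b \<in> Univ N" for b
  proof -
    obtain i where "b = n i"
      using from_nat_into_surj[OF N(2) b] unfolding n_def by metis
    then show ?thesis using S(4)[of i] unfolding R_def by blast
  qed
  from dom obtain h where h: "\<And>a. a \<in> Univ M \<Longrightarrow> (a, h a) \<in> R" by metis
  have "bij_betw h (Univ M) (Univ N)"
    unfolding bij_betw_def
  proof
    show "inj_on h (Univ M)" using h RD(4) by (metis inj_onI)
    show "h ` Univ M = Univ N"
    proof
      show "h ` Univ M \<subseteq> Univ N" using h RD(2) by blast
      show "Univ N \<subseteq> h ` Univ M"
      proof
        fix b assume "b \<in> Univ N"
        then obtain a where a: "(a, b) \<in> R" using ran by blast
        then have "b = h a" using RD(4)[OF a h] RD(1)[OF a] by blast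
        then show "b \<in> h ` Univ M" using RD(1)[OF a] by blast
      qed
    qed
  qed
  moreover have "h a \<in> Rl N \<longleftrightarrow> a \<in> Rl M" if "a \<in> Univ M" for a
    using RD(3)[OF h[OF that]] by simp
  moreover have "(h a, h b) \<in> P1 N \<longleftrightarrow> (a, b) \<in> P1 M" if "a \<in> Univ M" "b \<in> Univ M" for a b
    using RD(5)[OF h[OF that(1)] h[OF that(2)]] by simp
  ultimately show ?thesis by blast
qed

subsection \<open>Induced substructures\<close>

definition induced :: "'a bistruct \<Rightarrow> 'a set \<Rightarrow> 'a bistruct" where
  "induced G A = \<lparr>Univ = Univ G \<inter> A, Rl = Rl G \<inter> A, Rr = Rr G \<inter> A,
     P1 = P1 G \<inter> A \<times> A, P2 = P2 G \<inter> A \<times> A\<rparr>"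

lemma induced_simps [simp]:
  "Univ (induced G A) = Univ G \<inter> A" "Rl (induced G A) = Rl G \<inter> A" "Rr (induced G A) = Rr G \<inter> A"
  "P1 (induced G A) = P1 G \<inter> A \<times> A" "P2 (induced G A) = P2 G \<inter> A \<times> A"
  by (simp_all add: induced_def)

lemma substructure_induced:
  assumes "bipartite_graph G"
  shows "substructure (induced G A) G"
  using assms unfolding substructure_def bipartite_graph_def by auto

lemma substructure_induced_mono:
  assumes "bipartite_graph G" "A \<subseteq> B"
  shows "substructure (induced G A) (induced G B)"
  using assms unfolding substructure_def bipartite_graph_def by auto

lemma bipartite_induced:
  assumes "bipartite_graph G" "Rl G \<inter> A \<noteq> {}" "Rr G \<inter> A \<noteq> {}"
  shows "bipartite_graph (induced G A)"
  using assms unfolding bipartite_graph_def by auto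

text \<open>An instance of the property mentions finitely many vertices, all of which lie in
  \<open>A i\<close> for large \<open>i\<close>. A witness in the induced structure is a witness in
  \<open>G\<close>, since its edges are edges of \<open>G\<close>.\<close>

lemma extension_property_union:
  assumes "\<And>i. A i \<subseteq> A (Suc i)" "(\<Union>i::nat. A i) = UNIV"
    and "\<forall>\<^sub>F i in sequentially. extension_property n (induced G (A i))"
  shows "extension_property n G"
  unfolding extension_property_def
proof (intro allI impI)
  fix Xl1 Xl2 Xr1 Xr2
  assume X: "Xl1 \<subseteq> Rl G \<and> Xl2 \<subseteq> Rl G \<and> Xl1 \<inter> Xl2 = {} \<and>
        finite Xl1 \<and> card Xl1 \<le> n \<and> finite Xl2 \<and> card Xl2 \<le> n \<and>
        Xr1 \<subseteq> Rr G \<and> Xr2 \<subseteq> Rr G \<and> Xr1 \<inter> Xr2 = {} \<and>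
        finite Xr1 \<and> card Xr1 \<le> n \<and> finite Xr2 \<and> card Xr2 \<le> n"
  have mono: "A i \<subseteq> A j" if "i \<le> j" for i j
    using that assms(1) by (rule lift_Suc_mono_le[rotated])
  have "\<forall>\<^sub>F i in sequentially. x \<in> A i" for x
  proof -
    obtain i where "x \<in> A i" using assms(2) by blast
    then show ?thesis using mono unfolding eventually_sequentially by blast
  qed
  then have ev: "\<forall>\<^sub>F i in sequentially. \<forall>x\<in>X. x \<in> A i" if "finite X" for X
    using that by (simp add: eventually_ball_finite)
  have "\<forall>\<^sub>F i in sequentially. extension_property n (induced G (A i)) \<and> Xl1 \<union> Xl2 \<union> (Xr1 \<union> Xr2) \<subseteq> A i"
    using assms(3) ev[of "Xl1 \<union> Xl2 \<union> (Xr1 \<union> Xr2)"] X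
    by (auto elim: eventually_elim2)
  then obtain i where i: "extension_property n (induced G (A i))" "Xl1 \<union> Xl2 \<union> (Xr1 \<union> Xr2) \<subseteq> A i"
    by (auto simp: eventually_sequentially)
  have "Xl1 \<subseteq> Rl G \<inter> A i" "Xl2 \<subseteq> Rl G \<inter> A i" "Xr1 \<subseteq> Rr G \<inter> A i" "Xr2 \<subseteq> Rr G \<inter> A i"
    using X i(2) by auto
  with i(1)[unfolded extension_property_def, rule_format, of Xl1 Xl2 Xr1 Xr2] X
  have "(\<exists>v\<in>Rr G \<inter> A i. (\<forall>x\<in>Xl1. (x, v) \<in> P1 G \<inter> A i \<times> A i) \<and> (\<forall>x\<in>Xl2. (x, v) \<in> P2 G \<inter> A i \<times> A i)) \<and>
    (\<exists>w\<in>Rl G \<inter> A i. (\<forall>x\<in>Xr1. (w, x) \<in> P1 G \<inter> A i \<times> A i) \<and> (\<forall>x\<in>Xr2. (w, x) \<in> P2 G \<inter> A i \<times> A i))"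
    by (simp only: induced_simps simp_thms)
  then show "(\<exists>v\<in>Rr G. (\<forall>x\<in>Xl1. (x, v) \<in> P1 G) \<and> (\<forall>x\<in>Xl2. (x, v) \<in> P2 G)) \<and>
        (\<exists>w\<in>Rl G. (\<forall>x\<in>Xr1. (w, x) \<in> P1 G) \<and> (\<forall>x\<in>Xr2. (w, x) \<in> P2 G))"
    by blast
qed

text \<open>An isomorphism restricts to an isomorphism between a segment and its image. Assignments
  take values in \<open>Univ M\<close> and may leave \<open>A\<close>, so the atomic cases rest on
  \<open>h\<close> being injective on all of \<open>Univ M\<close>, while quantifiers range over
  \<open>A\<close>.\<close>

lemma sat_induced_image:
  assumes M: "bipartite_graph M" and N: "bipartite_graph N"
    and h: "bij_betw h (Univ M) (Univ N)" "\<And>a. a \<in> Univ M \<Longrightarrow> h a \<in> Rl N \<longleftrightarrow> a \<in> Rl M"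
      "\<And>a b. a \<in> Univ M \<Longrightarrow> b \<in> Univ M \<Longrightarrow> (h a, h b) \<in> P1 N \<longleftrightarrow> (a, b) \<in> P1 M"
    and A: "A \<subseteq> Univ M" and e: "\<And>x. e x \<in> Univ M"
  shows "sat (induced N (h ` A)) (h \<circ> e) p = sat (induced M A) e p"
proof -
  have inj: "h a = h b \<longleftrightarrow> a = b" if "a \<in> Univ M" "b \<in> Univ M" for a b
    using h(1) that by (auto simp: bij_betw_def inj_on_def)
  have mem: "h a \<in> h ` A \<longleftrightarrow> a \<in> A" if "a \<in> Univ M" for a
    using A inj that by (auto simp: image_iff)
  have hN: "h a \<in> Univ N" if "a \<in> Univ M" for a
    using h(1) that by (auto simp: bij_betw_def)
  have r: "h a \<in> Rr N \<longleftrightarrow> a \<in> Rr M" if "a \<in> Univ M" for a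
    using h(2)[OF that] Rr_iff[OF M that] Rr_iff[OF N hN[OF that]] by simp
  have P2: "(h a, h b) \<in> P2 N \<longleftrightarrow> (a, b) \<in> P2 M" if "a \<in> Univ M" "b \<in> Univ M" for a b
    using that by (simp add: P2_iff[OF M] P2_iff[OF N] hN h)
  have U: "Univ (induced N (h ` A)) = h ` A" "Univ (induced M A) = A"
    using A hN by auto
  show ?thesis
    using e
  proof (induction p arbitrary: e)
    case (ExF x p)
    have "sat (induced N (h ` A)) ((h \<circ> e)(x := h a)) p = sat (induced M A) (e(x := a)) p" if "a \<in> A" for a
    proof -
      have "(h \<circ> e)(x := h a) = h \<circ> e(x := a)" by auto
      moreover have "sat (induced N (h ` A)) (h \<circ> e(x := a)) p = sat (induced M A) (e(x := a)) p"
        using ExF.prems that A by (intro ExF.IH) auto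
      ultimately show ?thesis by (simp only:)
    qed
    then show ?case unfolding sat.simps U by blast
  next
    case (AllF x p)
    have "sat (induced N (h ` A)) ((h \<circ> e)(x := h a)) p = sat (induced M A) (e(x := a)) p" if "a \<in> A" for a
    proof -
      have "(h \<circ> e)(x := h a) = h \<circ> e(x := a)" by auto
      moreover have "sat (induced N (h ` A)) (h \<circ> e(x := a)) p = sat (induced M A) (e(x := a)) p"
        using AllF.prems that A by (intro AllF.IH) auto
      ultimately show ?thesis by (simp only:)
    qed
    then show ?case unfolding sat.simps U by blast
  qed (simp_all add: inj mem h r P2)
qed

subsection \<open>Coin flips\<close>

text \<open>With \<open>UNIV\<close> as index set the outcomes are all total functions.\<close>

definition coins :: "('i \<Rightarrow> bool) measure" where
  "coins = PiM UNIV (\<lambda>_. measure_pmf (bernoulli_pmf (1/2)))"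

lemma space_coins [simp]: "space coins = UNIV"
  by (simp add: coins_def space_PiM)

interpretation coins: product_prob_space "\<lambda>_::'i. measure_pmf (bernoulli_pmf (1/2))" UNIV
  rewrites "PiM (UNIV :: 'i set) (\<lambda>_. measure_pmf (bernoulli_pmf (1/2))) = coins"
  by (unfold_locales) (simp add: coins_def)

lemma UNIV_sets_coins [simp]: "UNIV \<in> sets coins"
  using sets.top[of coins] by simp

lemma measurable_coin: "(\<lambda>\<omega>. \<omega> i) \<in> measurable coins (measure_pmf (bernoulli_pmf (1/2)))"
  unfolding coins_def by (rule measurable_component_singleton) simp

lemma sets_coin: "{\<omega>. \<omega> i = b} \<in> sets coins"
  using measurable_sets[OF measurable_coin, of "{b}"] by (simp add: vimage_def)

lemma sets_pattern_avoided:
  assumes "finite V" "\<And>v. v \<in> V \<Longrightarrow> finite (D v)"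
  shows "{\<omega>. \<forall>v\<in>V. \<exists>i\<in>D v. \<omega> i \<noteq> t i} \<in> sets coins"
proof -
  have "{\<omega>. \<forall>v\<in>V. \<exists>i\<in>D v. \<omega> i \<noteq> t i} = (\<Inter>v\<in>V. \<Union>i\<in>D v. {\<omega>. \<omega> i = (\<not> t i)}) \<inter> space coins"
    by auto
  also have "\<dots> \<in> sets coins"
  proof (cases "V = {}")
    case False
    then show ?thesis using assms
      by (intro sets.Int sets.finite_INT sets.finite_UN sets_coin) auto
  qed simp
  finally show ?thesis .
qed

text \<open>The coordinates taken together form the identity map, so their joint law is
  \<open>coins\<close> itself, which is the product of the marginal laws.\<close>

lemma coins_indep: "coins.P.indep_vars (\<lambda>_. measure_pmf (bernoulli_pmf (1/2))) (\<lambda>(i :: 'i) \<omega>. \<omega> i) UNIV"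
proof (subst coins.P.indep_vars_iff_distr_eq_PiM')
  let ?p = "measure_pmf (bernoulli_pmf (1/2))"
  show "(\<lambda>\<omega>. \<omega> i) \<in> measurable coins ?p" for i :: 'i
    by (rule measurable_coin)
  have "distr coins ?p (\<lambda>\<omega>. \<omega> i) = ?p" for i :: 'i
    using coins.PiM_component[of i] by simp
  then show "distr coins (Pi\<^sub>M UNIV (\<lambda>_. ?p)) (\<lambda>x. \<lambda>i::'i\<in>UNIV. x i) = Pi\<^sub>M UNIV (\<lambda>i. distr coins ?p (\<lambda>\<omega>. \<omega> i))"
    by (simp add: coins_def[symmetric] restrict_UNIV)
qed simp

lemma prob_pattern:
  assumes "finite D"
  shows "measure coins {\<omega>. \<forall>i\<in>D. \<omega> i = t i} = (1/2) ^ card D"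
proof -
  have "emeasure coins {\<omega>\<in>space coins. \<forall>i\<in>D. \<omega> i \<in> {t i}} =
      (\<Prod>i\<in>D. emeasure (measure_pmf (bernoulli_pmf (1/2))) {t i})"
    using assms by (intro coins.emeasure_PiM_Collect) auto
  also have "\<dots> = (\<Prod>i\<in>D. ennreal (1/2))"
  proof (intro prod.cong refl)
    fix i show "emeasure (measure_pmf (bernoulli_pmf (1/2))) {t i} = ennreal (1/2)"
      by (cases "t i") (simp_all add: emeasure_pmf_single)
  qed
  also have "\<dots> = ennreal ((1/2) ^ card D)"
    by (simp only: prod_constant ennreal_power)
  finally show ?thesis by (simp add: measure_def)
qed

text \<open>The blocks \<open>D v\<close> are disjoint, so missing the pattern on different blocks
  gives independent events. Each has probability \<open>1 - (1/2) ^ card (D v)\<close>, which is at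
  most \<open>1 - (1/2) ^ k\<close>.\<close>

lemma prob_pattern_avoided:
  assumes V: "finite V" "disjoint_family_on D V"
    and D: "\<And>v. v \<in> V \<Longrightarrow> finite (D v)" "\<And>v. v \<in> V \<Longrightarrow> card (D v) \<le> k"
  shows "measure coins {\<omega>. \<forall>v\<in>V. \<exists>i\<in>D v. \<omega> i \<noteq> t i} \<le> (1 - (1/2) ^ k) ^ card V"
proof (cases "V = {}")
  case False
  let ?p = "measure_pmf (bernoulli_pmf (1/2))"
  \<comment> \<open>\<open>B v\<close> expresses the miss through the coins in \<open>D v\<close>
    alone; its preimage under restriction to \<open>D v\<close> is the event in the full
    space.\<close>
  define B where "B v = {f \<in> space (PiM (D v) (\<lambda>_. ?p)). \<exists>i\<in>D v. f i \<noteq> t i}" for v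
  have B: "B v \<in> sets (PiM (D v) (\<lambda>_. ?p))" if "v \<in> V" for v
    unfolding B_def
  proof (intro sets.sets_Collect_finite_Ex D(1) that)
    fix i assume "i \<in> D v"
    then have "(\<lambda>f. f i) \<in> measurable (PiM (D v) (\<lambda>_. ?p)) ?p" by measurable
    from measurable_sets[OF this, of "{\<not> t i}"]
    show "{f \<in> space (PiM (D v) (\<lambda>_. ?p)). f i \<noteq> t i} \<in> sets (PiM (D v) (\<lambda>_. ?p))"
      by (simp add: vimage_def Int_def conj_commute)
  qed
  have pre: "(\<lambda>\<omega>. restrict (\<lambda>i. \<omega> i) (D v)) -` B v \<inter> space coins = {\<omega>. \<exists>i\<in>D v. \<omega> i \<noteq> t i}" for v
    by (auto simp: B_def space_PiM)
  have "coins.P.indep_vars (\<lambda>v. PiM (D v) (\<lambda>_. ?p)) (\<lambda>v \<omega>. restrict (\<lambda>i. \<omega> i) (D v)) V"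
    using coins.P.indep_vars_restrict[OF coins_indep _ V(2)] by simp
  from coins.P.indep_varsD_finite[OF this False V(1), of B] B
  have "measure coins (\<Inter>v\<in>V. {\<omega>. \<exists>i\<in>D v. \<omega> i \<noteq> t i}) = (\<Prod>v\<in>V. measure coins {\<omega>. \<exists>i\<in>D v. \<omega> i \<noteq> t i})"
    by (simp only: pre)
  also have "\<dots> \<le> (\<Prod>v\<in>V. 1 - (1/2) ^ k)"
  proof (intro prod_mono conjI)
    fix v assume v: "v \<in> V"
    have "{\<omega>. \<exists>i\<in>D v. \<omega> i \<noteq> t i} = space coins - {\<omega>. \<forall>i\<in>D v. \<omega> i = t i}" by auto
    moreover have "{\<omega>. \<forall>i\<in>D v. \<omega> i = t i} \<in> sets coins"
    proof -
      have "{\<omega>. \<forall>i\<in>D v. \<omega> i = t i} = (\<Inter>i\<in>D v. {\<omega>. \<omega> i = t i}) \<inter> space coins" by auto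
      also have "\<dots> \<in> sets coins"
        using D(1)[OF v] by (cases "D v = {}") (auto intro!: sets.finite_INT sets_coin)
      finally show ?thesis .
    qed
    ultimately have "measure coins {\<omega>. \<exists>i\<in>D v. \<omega> i \<noteq> t i} = 1 - (1/2) ^ card (D v)"
      using coins.P.prob_compl[of "{\<omega>. \<forall>i\<in>D v. \<omega> i = t i}"] prob_pattern[OF D(1)[OF v], of t] by simp
    also have "\<dots> \<le> 1 - (1/2) ^ k"
      using D(2)[OF v] by (simp add: power_decreasing)
    finally show "measure coins {\<omega>. \<exists>i\<in>D v. \<omega> i \<noteq> t i} \<le> 1 - (1/2) ^ k" .
  qed simp
  also have "(\<Inter>v\<in>V. {\<omega>. \<exists>i\<in>D v. \<omega> i \<noteq> t i}) = {\<omega>. \<forall>v\<in>V. \<exists>i\<in>D v. \<omega> i \<noteq> t i}" by auto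
  finally show ?thesis by simp
qed simp

section \<open>Almost sure extension: counting, union bound and Borel-Cantelli\<close>

lemma card_small_subsets:
  "finite {X. X \<subseteq> {..<i::nat} \<and> card X \<le> n}" "card {X. X \<subseteq> {..<i::nat} \<and> card X \<le> n} \<le> (i + 1) ^ n"
proof -
  \<comment> \<open>Sets with fewer than \<open>n\<close> elements are listed with the dummy entry \<open>i\<close> as padding.\<close>
  have sub: "{X. X \<subseteq> {..<i} \<and> card X \<le> n} \<subseteq> (\<lambda>xs. set xs - {i}) ` {xs. set xs \<subseteq> {..i} \<and> length xs = n}" (is "?A \<subseteq> ?f ` ?L")
  proof
    fix X assume X: "X \<in> ?A"
    then have "finite X" by (auto intro: finite_subset)
    with X have "X = ?f (sorted_list_of_set X @ replicate (n - card X) i)"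
      "sorted_list_of_set X @ replicate (n - card X) i \<in> ?L"
      by auto
    then show "X \<in> ?f ` ?L" by blast
  qed
  have fin: "finite ?L" by (rule finite_lists_length_eq) simp
  show "finite ?A" using sub fin by (rule finite_subset[OF _ finite_imageI])
  have "card ?A \<le> card ?L" using surj_card_le[OF fin sub] .
  also have "\<dots> = (i + 1) ^ n" by (simp add: card_lists_length_eq)
  finally show "card ?A \<le> (i + 1) ^ n" .
qed

text \<open>Exponential decay beats every polynomial: up to a constant factor
  \<open>c ^ (i div 2)\<close> is at most \<open>exp (ln c / 2 * real i)\<close> with
  \<open>ln c < 0\<close>, so comparison with \<open>1 / real i ^ 2\<close> applies.\<close>

lemma summable_poly_geometric:
  assumes "0 < c" "c < (1::real)"
  shows "summable (\<lambda>i::nat. (real i + 1) ^ n * c ^ (i div 2))"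
proof (rule summable_comparison_test_bigo)
  show "summable (\<lambda>i::nat. norm (1 / real i ^ 2))"
    using inverse_power_summable[of 2] by (simp add: field_simps)
  have "(\<lambda>i. (real i + 1) ^ n * c ^ (i div 2)) \<in> O(\<lambda>i. (real i + 1) ^ n * exp (ln c / 2 * real i))"
  proof (rule bigoI[of _ "exp (- ln c)"], intro always_eventually allI)
    fix i
    have "c ^ (i div 2) = exp (ln c * real (i div 2))"
      using assms by (simp add: exp_of_nat_mult mult.commute[of "ln c"] exp_of_nat_mult)
    also have "ln c * real (i div 2) \<le> ln c / 2 * real i - ln c"
    proof -
      \<comment> \<open>Since \<open>ln c\<close> is negative, this lower bound on the exponent
        becomes an upper bound on the power; the unit lost here reappears as the constant factor
        \<open>exp (- ln c)\<close>.\<close>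
      have "real i / 2 - 1 \<le> real (i div 2)" by linarith
      from mult_left_mono_neg[OF this, of "ln c"] assms show ?thesis
        by (simp add: field_simps)
    qed
    finally have "c ^ (i div 2) \<le> exp (- ln c) * exp (ln c / 2 * real i)"
      by (simp add: exp_add[symmetric])
    then show "norm ((real i + 1) ^ n * c ^ (i div 2)) \<le> exp (- ln c) * norm ((real i + 1) ^ n * exp (ln c / 2 * real i))"
      using assms by (simp add: abs_mult mult.left_commute mult_left_mono)
  qed
  also have "ln c < 0" using assms by simp
  then have "(\<lambda>i::nat. (real i + 1) ^ n * exp (ln c / 2 * real i)) \<in> O(\<lambda>i. 1 / real i ^ 2)"
    by real_asymp
  finally show "(\<lambda>i. (real i + 1) ^ n * c ^ (i div 2)) \<in> O(\<lambda>i. 1 / real i ^ 2)" .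
qed

text \<open>The map \<open>\<pi>\<close> allows for both orders in which an edge between the two sides may be stored.\<close>

lemma AE_extension:
  fixes \<pi> :: "nat \<times> nat \<Rightarrow> 'i" and B :: "nat set"
  assumes \<pi>: "inj \<pi>" and B: "\<And>i. i div 2 \<le> card {v\<in>B. v < i}"
  shows "AE \<omega> in coins. \<forall>\<^sub>F i in sequentially. \<forall>X Y. X \<subseteq> {..<i} \<and> Y \<subseteq> {..<i} \<and> X \<inter> Y = {} \<and> card X \<le> n \<and> card Y \<le> n \<longrightarrow>
    (\<exists>v\<in>B. v < i \<and> (\<forall>x\<in>X. \<omega> (\<pi> (x, v))) \<and> (\<forall>x\<in>Y. \<not> \<omega> (\<pi> (x, v))))"
proof -
  define F where "F i = {X. X \<subseteq> {..<i::nat} \<and> card X \<le> n}" for i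
  define V where "V i = {v\<in>B. v < i}" for i
  \<comment> \<open>\<open>D X Y v\<close> holds the coins deciding the edges between
    \<open>v\<close> and \<open>X \<union> Y\<close>; \<open>t X\<close> is the wanted outcome on
    them, heads exactly for the edges to \<open>X\<close>. In \<open>avoid i p\<close> every
    candidate in \<open>V i\<close> misses this outcome for the pair \<open>p\<close>.\<close>
  define D where "D X Y v = (\<lambda>x. \<pi> (x, v)) ` (X \<union> Y)" for X Y v
  define t where "t X j = (\<exists>x\<in>X. \<exists>v. j = \<pi> (x, v))" for X j
  define avoid where "avoid i p = {\<omega>. \<forall>v\<in>V i. \<exists>j\<in>D (fst p) (snd p) v. \<omega> j \<noteq> t (fst p) j}" for i p
  \<comment> \<open>Overlapping pairs are included. This only enlarges \<open>bad i\<close> and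
    keeps the index set a product that is easy to count.\<close>
  define bad where "bad i = (\<Union>p\<in>F i \<times> F i. avoid i p)" for i
  have t: "t X (\<pi> (x, v)) \<longleftrightarrow> x \<in> X" for X x v
    using \<pi> by (auto simp: t_def inj_eq)
  have fin: "finite X" if "X \<in> F i" for X i
    using that by (auto simp: F_def intro: finite_subset)
  have finF: "finite (F i)" for i unfolding F_def by (rule card_small_subsets)
  have finV: "finite (V i)" for i by (simp add: V_def)
  have avoid_sets: "avoid i p \<in> sets coins" if "p \<in> F i \<times> F i" for i p
    unfolding avoid_def using that finV fin by (intro sets_pattern_avoided) (auto simp: D_def)
  then have bad_sets: "bad i \<in> sets coins" for i
    unfolding bad_def using finF by (intro sets.finite_UN) auto
  \<comment> \<open>A pattern involves at most \<open>2 * n\<close> coins; the successor keeps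
    \<open>c\<close> positive for \<open>n = 0\<close> as well.\<close>
  define c where "c = 1 - (1/2::real) ^ Suc (2 * n)"
  have c: "0 < c" "c < 1"
    by (simp_all add: c_def power_Suc_less_one del: power_Suc)
  have "measure coins (avoid i p) \<le> c ^ (i div 2)" if "p \<in> F i \<times> F i" for i p
  proof -
    have "measure coins (avoid i p) \<le> (1 - (1/2) ^ Suc (2 * n)) ^ card (V i)"
      unfolding avoid_def
    proof (rule prob_pattern_avoided)
      \<comment> \<open>Injectivity of \<open>\<pi>\<close> gives distinct candidates distinct
        coins, which makes their failures independent.\<close>
      show "disjoint_family_on (D (fst p) (snd p)) (V i)"
        using \<pi> by (auto simp: disjoint_family_on_def D_def inj_eq)
      show "card (D (fst p) (snd p) v) \<le> Suc (2 * n)" for v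
      proof -
        have "card (D (fst p) (snd p) v) \<le> card (fst p \<union> snd p)"
          unfolding D_def using that fin by (intro card_image_le) auto
        also have "\<dots> \<le> card (fst p) + card (snd p)" by (rule card_Un_le)
        also have "\<dots> \<le> Suc (2 * n)" using that by (auto simp: F_def)
        finally show ?thesis .
      qed
    qed (use finV that fin in \<open>auto simp: D_def\<close>)
    also have "\<dots> \<le> c ^ (i div 2)"
      unfolding c_def[symmetric] using B[of i] c by (intro power_decreasing) (auto simp: V_def)
    finally show ?thesis .
  qed
  \<comment> \<open>Union bound: the number of pairs is polynomial in \<open>i\<close>, while the
    bound on each failure decays geometrically.\<close>
  then have "measure coins (bad i) \<le> (\<Sum>p\<in>F i \<times> F i. c ^ (i div 2))" for i
    unfolding bad_def using finF avoid_sets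
    by (intro order.trans[OF coins.P.finite_measure_subadditive_finite] sum_mono) auto
  also have "(\<Sum>p\<in>F i \<times> F i. c ^ (i div 2)) \<le> (real i + 1) ^ (2 * n) * c ^ (i div 2)" for i
  proof -
    have "card (F i) * card (F i) \<le> (i + 1) ^ n * (i + 1) ^ n"
      unfolding F_def by (intro mult_mono card_small_subsets) auto
    then have "real (card (F i) * card (F i)) \<le> real ((i + 1) ^ n * (i + 1) ^ n)"
      by (rule of_nat_mono)
    then have "real (card (F i \<times> F i)) \<le> (real i + 1) ^ (2 * n)"
      by (simp add: mult_2 power_add card_cartesian_product add.commute)
    then show ?thesis using c by (simp add: mult_right_mono)
  qed
  finally have bound: "measure coins (bad i) \<le> (real i + 1) ^ (2 * n) * c ^ (i div 2)" for i .
  \<comment> \<open>By the first Borel-Cantelli lemma, summable probabilities put almost every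
    outcome in only finitely many of the sets \<open>bad i\<close>.\<close>
  have "AE \<omega> in coins. \<forall>\<^sub>F i in sequentially. \<omega> \<in> space coins - bad i"
  proof (rule borel_cantelli_AE1)
    show "summable (\<lambda>i. measure coins (bad i))"
      by (rule summable_comparison_test_ev[OF _ summable_poly_geometric[OF c, of "2 * n"]])
        (use bound in auto)
  qed (simp_all add: bad_sets coins.P.emeasure_eq_measure)
  then show ?thesis
  proof (rule AE_mp, intro AE_I2 impI)
    fix \<omega> assume "\<forall>\<^sub>F i in sequentially. \<omega> \<in> space coins - bad i"
    then show "\<forall>\<^sub>F i in sequentially. \<forall>X Y. X \<subseteq> {..<i} \<and> Y \<subseteq> {..<i} \<and> X \<inter> Y = {} \<and> card X \<le> n \<and> card Y \<le> n \<longrightarrow>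
      (\<exists>v\<in>B. v < i \<and> (\<forall>x\<in>X. \<omega> (\<pi> (x, v))) \<and> (\<forall>x\<in>Y. \<not> \<omega> (\<pi> (x, v))))"
    proof (rule eventually_mono, intro allI impI)
      fix i X Y assume "\<omega> \<in> space coins - bad i"
        and XY: "X \<subseteq> {..<i} \<and> Y \<subseteq> {..<i} \<and> X \<inter> Y = {} \<and> card X \<le> n \<and> card Y \<le> n"
      then have "\<omega> \<notin> avoid i (X, Y)" by (auto simp: bad_def F_def)
      then obtain v where "v \<in> V i" "\<And>j. j \<in> D X Y v \<Longrightarrow> \<omega> j = t X j"
        by (auto simp: avoid_def)
      then have "v \<in> B" "v < i" "\<And>x. x \<in> X \<union> Y \<Longrightarrow> \<omega> (\<pi> (x, v)) \<longleftrightarrow> x \<in> X"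
        by (auto simp: V_def D_def t)
      then show "\<exists>v\<in>B. v < i \<and> (\<forall>x\<in>X. \<omega> (\<pi> (x, v))) \<and> (\<forall>x\<in>Y. \<not> \<omega> (\<pi> (x, v)))"
        using XY by (intro bexI[of _ v]) auto
    qed
  qed
qed

subsection \<open>Random graphs on the natural numbers\<close>

text \<open>Parity gives the segments \<open>{..<i}\<close> the side sizes demanded of the chain:
  equal for even \<open>i\<close>, one more on the left for odd \<open>i\<close>, because
  \<open>0\<close> is on the left.\<close>

definition parity_graph :: "(nat \<Rightarrow> nat \<Rightarrow> bool) \<Rightarrow> nat bistruct" where
  "parity_graph E = \<lparr>Univ = UNIV, Rl = {x. even x}, Rr = {x. odd x},
     P1 = {(x, v). even x \<and> odd v \<and> E x v}, P2 = {(x, v). even x \<and> odd v \<and> \<not> E x v}\<rparr>"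

lemma parity_graph_simps [simp]:
  "Univ (parity_graph E) = UNIV" "Rl (parity_graph E) = {x. even x}" "Rr (parity_graph E) = {x. odd x}"
  "P1 (parity_graph E) = {(x, v). even x \<and> odd v \<and> E x v}"
  "P2 (parity_graph E) = {(x, v). even x \<and> odd v \<and> \<not> E x v}"
  by (simp_all add: parity_graph_def)

lemma bipartite_parity_graph: "bipartite_graph (parity_graph E)"
  unfolding bipartite_graph_def by (auto intro: exI[of _ 1] exI[of _ 0])

lemma card_even_odd_lessThan:
  "card {x. x < i \<and> even x} = (i + 1) div 2" "card {x. x < i \<and> odd x} = i div 2"
proof (induction i)
  case (Suc i)
  have e: "{x. x < Suc i \<and> P x} = (if P i then insert i {x. x < i \<and> P x} else {x. x < i \<and> P x})" for P
    by (auto simp: less_Suc_eq)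
  case 1
  show ?case using Suc by (subst e) auto
  case 2
  show ?case using Suc by (subst e) auto
qed auto

lemma bipartite_initial_segment:
  assumes "2 \<le> i"
  shows "bipartite_graph (induced (parity_graph E) {..<i})"
proof (rule bipartite_induced[OF bipartite_parity_graph])
  have "0 \<in> Rl (parity_graph E) \<inter> {..<i}" "1 \<in> Rr (parity_graph E) \<inter> {..<i}"
    using assms by auto
  then show "Rl (parity_graph E) \<inter> {..<i} \<noteq> {}" "Rr (parity_graph E) \<inter> {..<i} \<noteq> {}"
    by blast+
qed

text \<open>For each \<open>n\<close> and each side almost every outcome works. These are countably
  many conditions, so a single outcome meets them all.\<close>

lemma random_parity_graph:
  "\<exists>E. \<forall>n. \<forall>\<^sub>F i in sequentially. extension_property n (induced (parity_graph E) {..<i})"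
proof -
  let ?ext = "\<lambda>\<pi> B n \<omega> i. \<forall>X Y. X \<subseteq> {..<i} \<and> Y \<subseteq> {..<i} \<and> X \<inter> Y = {} \<and> card X \<le> n \<and> card Y \<le> n \<longrightarrow>
    (\<exists>v\<in>B. v < i \<and> (\<forall>x\<in>X. \<omega> (\<pi> (x, v))) \<and> (\<forall>x\<in>Y. \<not> \<omega> (\<pi> (x, v))))"
  \<comment> \<open>The coin of an edge is indexed by its even end first. When the witness is the
    even end, \<open>prod.swap\<close> moves it to the first place, so both statements read the same
    coin for the same edge.\<close>
  have "AE \<omega> in coins. \<forall>\<^sub>F i in sequentially. ?ext (\<lambda>p. p) {v. odd v} n \<omega> i"
    "AE \<omega> in coins. \<forall>\<^sub>F i in sequentially. ?ext prod.swap {v. even v} n \<omega> i" for n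
    using card_even_odd_lessThan by (intro AE_extension; simp add: conj_commute)+
  then have "AE \<omega> in coins. \<forall>n. (\<forall>\<^sub>F i in sequentially. ?ext (\<lambda>p. p) {v. odd v} n \<omega> i) \<and>
      (\<forall>\<^sub>F i in sequentially. ?ext prod.swap {v. even v} n \<omega> i)"
    by (simp add: AE_all_countable)
  then obtain \<omega> where \<omega>: "\<And>n. \<forall>\<^sub>F i in sequentially. ?ext (\<lambda>p. p) {v. odd v} n \<omega> i"
    "\<And>n. \<forall>\<^sub>F i in sequentially. ?ext prod.swap {v. even v} n \<omega> i"
    using eventually_happens'[OF coins.P.ae_filter_bot] by blast
  define H where "H = parity_graph (curry \<omega>)"
  have "\<forall>\<^sub>F i in sequentially. extension_property n (induced H {..<i})" for n
    using \<omega>[of n] eventually_ge_at_top[of 2]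
  proof eventually_elim
    case (elim i)
    have "bipartite_graph (induced H {..<i})"
      unfolding H_def using elim(3) by (rule bipartite_initial_segment)
    moreover have "one_sided_extension n (Rl (induced H {..<i})) (Rr (induced H {..<i}))
        (\<lambda>x v. (x, v) \<in> P1 (induced H {..<i}))"
      unfolding one_sided_extension_def
    proof (intro allI impI)
      fix X Y
      assume *: "X \<subseteq> Rl (induced H {..<i}) \<and> Y \<subseteq> Rl (induced H {..<i}) \<and> X \<inter> Y = {} \<and>
        finite X \<and> card X \<le> n \<and> finite Y \<and> card Y \<le> n"
      then obtain v where "odd v" "v < i" "\<forall>x\<in>X. \<omega> (x, v)" "\<forall>x\<in>Y. \<not> \<omega> (x, v)"
        using elim(1)[rule_format, of X Y] by (auto simp: H_def)
      then show "\<exists>v\<in>Rr (induced H {..<i}). (\<forall>x\<in>X. (x, v) \<in> P1 (induced H {..<i})) \<and>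
          (\<forall>x\<in>Y. (x, v) \<notin> P1 (induced H {..<i}))"
        using * by (intro bexI[of _ v]) (auto simp: H_def)
    qed
    moreover have "one_sided_extension n (Rr (induced H {..<i})) (Rl (induced H {..<i}))
        (\<lambda>v x. (x, v) \<in> P1 (induced H {..<i}))"
      unfolding one_sided_extension_def
    proof (intro allI impI)
      fix X Y
      assume *: "X \<subseteq> Rr (induced H {..<i}) \<and> Y \<subseteq> Rr (induced H {..<i}) \<and> X \<inter> Y = {} \<and>
        finite X \<and> card X \<le> n \<and> finite Y \<and> card Y \<le> n"
      then obtain v where "even v" "v < i" "\<forall>x\<in>X. \<omega> (v, x)" "\<forall>x\<in>Y. \<not> \<omega> (v, x)"
        using elim(2)[rule_format, of X Y] by (auto simp: H_def)
      then show "\<exists>v\<in>Rl (induced H {..<i}). (\<forall>x\<in>X. (v, x) \<in> P1 (induced H {..<i})) \<and>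
          (\<forall>x\<in>Y. (v, x) \<notin> P1 (induced H {..<i}))"
        using * by (intro bexI[of _ v]) (auto simp: H_def)
    qed
    ultimately show ?case
      by (simp only: extension_property_iff simp_thms)
  qed
  then show ?thesis unfolding H_def by blast
qed

section \<open>The chain of substructures of the random bipartite graph\<close>

theorem theorem3p2:
  fixes G :: "'a bistruct"
  assumes "random_bipartite_graph G"
  shows "SFBSP G"
proof -
  have G: "bipartite_graph G" "countable (Univ G)" "\<And>n. extension_property n G"
    using assms unfolding random_bipartite_graph_def by auto
  obtain E where E: "\<And>n. \<forall>\<^sub>F i in sequentially. extension_property n (induced (parity_graph E) {..<i})"
    using random_parity_graph by blast
  define H where "H = parity_graph E"
  have UH: "Univ H = UNIV" by (simp add: H_def)
  have H: "bipartite_graph H" "countable (Univ H)"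
    by (simp_all add: H_def bipartite_parity_graph)
  \<comment> \<open>The initial segments exhaust \<open>H\<close> and eventually have the property,
    so \<open>H\<close> has it too and back-and-forth carries \<open>H\<close> onto
    \<open>G\<close>.\<close>
  have "extension_property n H" for n
    unfolding H_def by (rule extension_property_union[OF _ _ E]) auto
  from back_and_forth[OF H this G]
  obtain h where h: "bij_betw h UNIV (Univ G)" "\<And>a. h a \<in> Rl G \<longleftrightarrow> a \<in> Rl H"
    "\<And>a b. (h a, h b) \<in> P1 G \<longleftrightarrow> (a, b) \<in> P1 H"
    unfolding UH by blast
  have inj: "inj h" and hU: "range h = Univ G"
    using h(1) by (auto simp: bij_betw_def)
  have card_h: "card (h ` A) = card A" for A
    by (rule card_image[OF inj_on_subset[OF inj subset_UNIV]])
  have hl: "h a \<in> Rl G \<longleftrightarrow> even a" for a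
    by (simp add: h(2) H_def)
  have hr: "h a \<in> Rr G \<longleftrightarrow> odd a" for a
    using Rr_iff[OF G(1), of "h a"] hU hl by auto
  \<comment> \<open>The chain adds \<open>h 0\<close>, \<open>h 1\<close> and so on, one vertex at a
    time, alternating between the sides and starting on the left.\<close>
  define C where "C i = induced G (h ` {..<i})" for i
  have UC: "Univ (C i) = h ` {..<i}" for i
    using hU by (auto simp: C_def)
  have "infinite (Univ G)"
    using hU inj by (metis finite_imageD infinite_UNIV_nat)
  moreover have "substructure (C i) G" for i
    unfolding C_def by (rule substructure_induced[OF G(1)])
  moreover have "Univ G = (\<Union>i. Univ (C i))"
    unfolding UC hU[symmetric] by auto
  moreover have "substructure (C i) (C (Suc i))" for i
    unfolding C_def by (rule substructure_induced_mono[OF G(1)]) auto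
  moreover have "Univ (C i) \<subset> Univ (C (Suc i))" for i
    unfolding UC by (simp add: psubset_eq image_mono inj_image_eq_iff[OF inj])
  moreover have "finite (Univ (C i)) \<and> card (Univ (C i)) = i" for i
    by (simp add: UC card_h)
  moreover have "if even i
      then card (Univ (C i) \<inter> Rl G) = card (Univ (C i) \<inter> Rr G)
      else card (Univ (C i) \<inter> Rl G) = card (Univ (C i) \<inter> Rr G) + 1" for i
  proof -
    have "Univ (C i) \<inter> Rl G = h ` {x. x < i \<and> even x}" "Univ (C i) \<inter> Rr G = h ` {x. x < i \<and> odd x}"
      unfolding UC using hl hr by auto
    then show ?thesis
      by (simp add: card_h card_even_odd_lessThan)
  qed
  moreover have "\<exists>N. \<forall>i\<ge>N. models (C i) p" if p: "sentence p" "models G p" for p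
  proof -
    obtain k where k: "\<forall>(M :: nat bistruct) (N :: 'a bistruct) e e'.
        bipartite_graph M \<longrightarrow> bipartite_graph N \<longrightarrow> extension_property k M \<longrightarrow> extension_property k N \<longrightarrow>
        partial_iso M N ((\<lambda>x. (e x, e' x)) ` fv p) \<longrightarrow> sat M e p = sat N e' p"
      using sat_transfer by blast
    \<comment> \<open>From some point on the segment of \<open>H\<close> has level \<open>k\<close>,
      and from \<open>i = 2\<close> on both its sides are nonempty. It then agrees with
      \<open>G\<close> on \<open>p\<close>, and \<open>h\<close> carries this agreement over to
      \<open>C i\<close>.\<close>
    have "\<forall>\<^sub>F i in sequentially. models (C i) p"
      using E[of k] eventually_ge_at_top[of 2]
    proof eventually_elim
      case (elim i)
      \<comment> \<open>The constant \<open>0\<close> is an arbitrary choice: a sentence has no free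
        variables, so the comparison starts from the empty partial isomorphism.\<close>
      define e :: "nat \<Rightarrow> nat" where "e = (\<lambda>_. 0)"
      have "bipartite_graph (induced H {..<i})"
        unfolding H_def using elim(2) by (rule bipartite_initial_segment)
      moreover have "partial_iso (induced H {..<i}) G ((\<lambda>x. (e x, (h \<circ> e) x)) ` fv p)"
        using p(1) by (simp add: sentence_def)
      ultimately have "sat (induced H {..<i}) e p = sat G (h \<circ> e) p"
        using elim(1) by (intro k[rule_format] G) (simp_all add: H_def)
      moreover have "sat (C i) (h \<circ> e) p = sat (induced H {..<i}) e p"
        unfolding C_def by (rule sat_induced_image[OF H(1) G(1)]) (use h UH in auto)
      ultimately show ?case
        using p models_iff_sat by metis
    qed
    then show ?thesis by (simp add: eventually_sequentially)
  qed
  ultimately show ?thesis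
    unfolding SFBSP_def using G(1,2) by (intro conjI exI[of _ C]) auto
qed

end
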